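(* Assume a Gaussian policy $\pi_\phi(\cdot\mid s)=\mathcal{N}(\mu_\phi(s),\Sigma)$ with parameters $\phi\in\mathbb{R}^m$ and fixed positive definite covariance $\Sigma$, denote the policy noise by $Z\sim\mathcal{N}(0,\Sigma)$, and assume that the proxy reward $\widetilde{R}(s,a)$ is $\beta$-smooth in $a$. Let $\mathfrak{J}(\phi^* ):=\nabla_\phi\mu_\phi(s)|_{\phi=\phi^*}$ be the Jacobian matrix of the mean action $\mu_\phi(s)$, assumed to have full row rank. If $\phi^*$ is an $\mathcal{E}$-$\widehat{L}$ flat reward maximum for $\widetilde{R}$, then the proxy reward action gradient $\|\nabla_a\widetilde{R}(s,\mu_{\phi^*}(s))\|$ is bounded by $$G:=\frac{\widehat{L}}{D^*}+\frac{\beta}{2}D^*+\beta\,\mathbb{E}[\|Z\|],$$ where $D^*$ is the action-robustness radius induced by the flatness (that is, $\phi^*$ is $D^*$-$\widehat{L}$ action robust), with $$D^*\le\|\mathfrak{J}(\phi^* )\|\,\mathcal{E}+\mathcal{O}(\mathcal{E}^2).$$ For given $\delta>0$ and $K>0$ with $K/\delta>G$, no pairwise violations can occur within the radius $r:=\frac{1}{\beta}\left(\frac{K}{\delta}-G\right)$ around the mean action, i.e. there are no actions $a_1,a_2$ with $\|a_1-\mu_{\phi^*}(s)\|\le r$, $\|a_2-\mu_{\phi^*}(s)\|\le r$, $\|a_1-a_2\|\le\delta$ and $|\widetilde{R}(s,a_1)-\widetilde{R}(s,a_2)|>K$; and thus the policy $\pi_{\phi^*}$ is $(\delta,K,\rho)$-pairwise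 robust for $\widetilde{R}$ with $$P(S_{K,\delta}(\widetilde{R})\mid\pi_{\phi^*})\le 2\,P(\|Z\|>r)=:\rho.$$
   Context: States (prompts) $s$ are drawn from a distribution $P(s)$; actions $a$ lie in a continuous (Euclidean) action space $\mathcal{A}$. The symbol $s$ in the hypotheses and in the gradient bound stands for an arbitrary state: the flatness, smoothness and rank conditions are required at every state, and $D^*$ is a radius of action robustness valid at every state. The proxy reward $\widetilde{R}(s,a)$ is real-valued. The term $\mathcal{O}(\mathcal{E}^2)$ is the remainder coming from the first-order Taylor expansion $\mu_{\phi^*+\epsilon}(s)=\mu_{\phi^*}(s)+\mathfrak{J}(\phi^* )\epsilon+\mathcal{O}(\|\epsilon\|^2)$ with $\|\epsilon\|\le\mathcal{E}$. $\beta$-smooth in $a$: for all $s$, $\|\nabla_a\widetilde{R}(s,a_1)-\nabla_a\widetilde{R}(s,a_2)\|\le\beta\|a_1-a_2\|$ for all $a_1,a_2\in\mathcal{A}$. $\mathcal{E}$-$\widehat{L}$ flat reward maximum: a maximum $\phi^*$ is $\mathcal{E}$-$\widehat{L}$ flat if for all $\epsilon\in\mathbb{R}^m$ with $\|\epsilon\|\le\mathcal{E}$, $\mathbb{E}_{a\sim\pi_{\phi^*}(\cdot\mid s)}[\widetilde{R}(s,a)]-\mathbb{E}_{a\sim\pi_{\phi^*+\epsilon}(\cdot\mid s)}[\widetilde{R}(s,a)]\le\widehat{L}$. $D$-$\widehat{L}$ action robust: $\phi^*$ is $D$-$\widehat{L}$ action robust if for all action perturbations $\eta$ with $\|\eta\|\le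 D$, $\mathbb{E}_{a\sim\pi_{\phi^*}(\cdot\mid s)}[\widetilde{R}(s,a)]-\mathbb{E}_{a\sim\pi_{\phi^*}(\cdot\mid s)}[\widetilde{R}(s,a+\eta)]\le\widehat{L}$. Sharpness set: for a reward $R$, $S_{K,\delta}(R):=\{(s,a_1,a_2):\|a_1-a_2\|\le\delta,\ |R(s,a_1)-R(s,a_2)|>K\}$. $P(S_{K,\delta}(R)\mid\pi_\phi)$ is the probability of this set when $s\sim P(s)$ and $a_1,a_2$ are drawn i.i.d. from $\pi_\phi(\cdot\mid s)$. A policy $\pi_\phi$ is $(\delta,K,\rho)$-pairwise robust for $R$ if $P(S_{K,\delta}(R)\mid\pi_\phi)\le\rho$.
   Formalization: A D* > 0 valid at all states need not exist if states are infinite, so it is proved to exist over finitely many; D*'s bound is for radii realised by parameter changes within E at every state, the rest for any robustness radius D* > 0; the mean is assumed continuous in φ on the E-ball around φ*. *)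

theory Defs
  imports "HOL-Probability.Probability"
begin

text \<open>States have type \<open>'s\<close> and range over the space of the state distribution
  \<open>P :: 's measure\<close>; actions live in \<open>real^'n\<close> and policy parameters in \<open>real^'m\<close>.
  A (parametrised) policy sends a parameter and a state to a measure on actions,
  a mean action map sends them to an action.\<close>

subsection \<open>Gaussian policies\<close>

definition positive_definite :: "real^'n^'n \<Rightarrow> bool" where
  "positive_definite A \<longleftrightarrow> transpose A = A \<and> (\<forall>x. x \<noteq> 0 \<longrightarrow> x \<bullet> (A *v x) > 0)"

definition gaussian :: "real^'n \<Rightarrow> real^'n^'n \<Rightarrow> (real^'n) measure" where
  "gaussian \<mu> C = density lborel (\<lambda>x. ennreal
     (exp (- ((x - \<mu>) \<bullet> (matrix_inv C *v (x - \<mu>))) / 2) / sqrt ((2 * pi) ^ CARD('n) * det C)))"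

definition gaussian_policy ::
  "(real^'m \<Rightarrow> 's \<Rightarrow> real^'n) \<Rightarrow> real^'n^'n \<Rightarrow> real^'m \<Rightarrow> 's \<Rightarrow> (real^'n) measure" where
  "gaussian_policy \<mu> C \<phi> s = gaussian (\<mu> \<phi> s) C"

subsection \<open>Smoothness of the reward in the action\<close>

definition grad :: "(real^'n \<Rightarrow> real) \<Rightarrow> real^'n \<Rightarrow> real^'n" where
  "grad f a = (THE D. GDERIV f a :> D)"

definition beta_smooth :: "'s set \<Rightarrow> real \<Rightarrow> ('s \<Rightarrow> real^'n \<Rightarrow> real) \<Rightarrow> bool" where
  "beta_smooth S \<beta> R \<longleftrightarrow> (\<forall>s\<in>S. (\<forall>a. R s differentiable (at a)) \<and>
     (\<forall>a1 a2. norm (grad (R s) a1 - grad (R s) a2) \<le> \<beta> * norm (a1 - a2)))"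

subsection \<open>Flatness and action robustness\<close>

text \<open>Flatness is the inequality alone: \<open>\<phi>\<close> is not additionally required to maximise some
  objective, so a statement assuming \<open>flat_reward\<close> covers every notion of (local or global,
  statewise or averaged) reward maximum.\<close>

definition flat_reward ::
  "'s set \<Rightarrow> (real^'m \<Rightarrow> 's \<Rightarrow> (real^'n) measure) \<Rightarrow> ('s \<Rightarrow> real^'n \<Rightarrow> real) \<Rightarrow>
   real^'m \<Rightarrow> real \<Rightarrow> real \<Rightarrow> bool" where
  "flat_reward S \<pi> R \<phi> E L \<longleftrightarrow> (\<forall>s\<in>S. \<forall>\<epsilon>. norm \<epsilon> \<le> E \<longrightarrow>
     (LINT a|\<pi> \<phi> s. R s a) - (LINT a|\<pi> (\<phi> + \<epsilon>) s. R s a) \<le> L)"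

definition action_robust ::
  "'s set \<Rightarrow> (real^'m \<Rightarrow> 's \<Rightarrow> (real^'n) measure) \<Rightarrow> ('s \<Rightarrow> real^'n \<Rightarrow> real) \<Rightarrow>
   real^'m \<Rightarrow> real \<Rightarrow> real \<Rightarrow> bool" where
  "action_robust S \<pi> R \<phi> D L \<longleftrightarrow> (\<forall>s\<in>S. \<forall>\<eta>. norm \<eta> \<le> D \<longrightarrow>
     (LINT a|\<pi> \<phi> s. R s a) - (LINT a|\<pi> \<phi> s. R s (a + \<eta>)) \<le> L)"

text \<open>The action radius induced by a parameter radius \<open>E\<close>: at every state of \<open>S\<close>, each action
  displacement of norm at most \<open>D\<close> is the displacement of the mean action caused by some
  parameter perturbation of norm at most \<open>E\<close>.\<close>

definition induced_radius ::
  "'s set \<Rightarrow> (real^'m \<Rightarrow> 's \<Rightarrow> real^'n) \<Rightarrow> real^'m \<Rightarrow> real \<Rightarrow> real \<Rightarrow> bool" where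
  "induced_radius S \<mu> \<phi> E D \<longleftrightarrow> (\<forall>s\<in>S. \<forall>\<eta>. norm \<eta> \<le> D \<longrightarrow>
     (\<exists>\<epsilon>. norm \<epsilon> \<le> E \<and> \<mu> (\<phi> + \<epsilon>) s = \<mu> \<phi> s + \<eta>))"

text \<open>\<open>T s\<close> is an explicit constant for the remainder \<open>O(\<parallel>\<epsilon>\<parallel>\<^sup>2)\<close> of the first-order expansion of the
  mean action at state \<open>s\<close>. A remainder term \<open>O(E\<^sup>2)\<close> stemming from it can then be stated as
  \<open>T s * E\<^sup>2\<close>; with \<open>E\<close> fixed, an existentially quantified constant would say nothing.\<close>

definition taylor_bound ::
  "'s set \<Rightarrow> (real^'m \<Rightarrow> 's \<Rightarrow> real^'n) \<Rightarrow> real^'m \<Rightarrow> real \<Rightarrow> ('s \<Rightarrow> real) \<Rightarrow> bool" where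
  "taylor_bound S \<mu> \<phi> E T \<longleftrightarrow> (\<forall>s\<in>S. \<forall>\<epsilon>. norm \<epsilon> \<le> E \<longrightarrow>
     norm (\<mu> (\<phi> + \<epsilon>) s - (\<mu> \<phi> s + jacobian (\<lambda>\<psi>. \<mu> \<psi> s) (at \<phi>) *v \<epsilon>)) \<le> T s * (norm \<epsilon>)\<^sup>2)"

subsection \<open>Pairwise robustness\<close>

text \<open>States are restricted to \<open>space P\<close> so that the sharpness set is a subset of the space of
  \<open>pair_law P \<pi>\<close>; otherwise it would not be measurable and get measure 0.\<close>

definition sharpness_set ::
  "'s measure \<Rightarrow> real \<Rightarrow> real \<Rightarrow> ('s \<Rightarrow> real^'n \<Rightarrow> real) \<Rightarrow> ('s \<times> (real^'n) \<times> (real^'n)) set" where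
  "sharpness_set P K \<delta> R =
     {(s, a1, a2). s \<in> space P \<and> norm (a1 - a2) \<le> \<delta> \<and> \<bar>R s a1 - R s a2\<bar> > K}"

text \<open>The law of \<open>(s, a1, a2)\<close> with \<open>s\<close> drawn from \<open>P\<close> and \<open>a1\<close>, \<open>a2\<close> drawn independently from
  \<open>\<pi> s\<close>.\<close>

definition pair_law ::
  "'s measure \<Rightarrow> ('s \<Rightarrow> (real^'n) measure) \<Rightarrow> ('s \<times> (real^'n) \<times> (real^'n)) measure" where
  "pair_law P \<pi> = do {
     s \<leftarrow> P;
     a1 \<leftarrow> \<pi> s;
     a2 \<leftarrow> \<pi> s;
     return (P \<Otimes>\<^sub>M (borel \<Otimes>\<^sub>M borel)) (s, a1, a2)
   }"

definition pairwise_robust ::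
  "'s measure \<Rightarrow> ('s \<Rightarrow> (real^'n) measure) \<Rightarrow> ('s \<Rightarrow> real^'n \<Rightarrow> real) \<Rightarrow>
   real \<Rightarrow> real \<Rightarrow> real \<Rightarrow> bool" where
  "pairwise_robust P \<pi> R \<delta> K \<rho> \<longleftrightarrow> measure (pair_law P \<pi>) (sharpness_set P K \<delta> R) \<le> \<rho>"

end

theory Submission
  imports Defs
begin

text \<open>The mean action map is a submersion at \<open>\<phi>\<close>, so by the open mapping property every small action
  displacement is the displacement of the mean under a parameter perturbation in the \<open>E\<close>-ball;
  since Gaussian policies with fixed covariance are translates of each other, flatness in
  parameters becomes robustness against shifts of the action. Robustness against a shift by \<open>D\<close>
  along \<open>- grad R\<close> at the mean, together with the descent inequality averaged over the noise,
  bounds the gradient at the mean by \<open>G\<close>. Smoothness then gives slope at most \<open>G + \<beta> r = K / \<delta>\<close>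
  on the \<open>r\<close>-ball around the mean, so a violating pair has an action outside this ball.
  The averaging needs the Gaussian to have mass 1 and a finite second moment, both obtained from
  the standard Gaussian by a linear change of variables.\<close>

subsection \<open>Linear change of variables\<close>

lemma nn_integral_lborel_translation:
  fixes f :: "'a::euclidean_space \<Rightarrow> ennreal"
  assumes [measurable]: "f \<in> borel_measurable borel"
  shows "(\<integral>\<^sup>+x. f (c + x) \<partial>lborel) = (\<integral>\<^sup>+x. f x \<partial>lborel)"
proof -
  have "(\<integral>\<^sup>+x. f x \<partial>lborel) = (\<integral>\<^sup>+x. f x \<partial>distr lborel borel ((+) c))"
    by (simp add: lborel_distr_plus)
  also have "\<dots> = (\<integral>\<^sup>+x. f (c + x) \<partial>lborel)"
    by (rule nn_integral_distr) auto
  finally show ?thesis ..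
qed

lemma borel_measurable_matrix_vector_mult [measurable]:
  fixes A :: "real^'n^'m"
  shows "(*v) A \<in> borel_measurable borel"
  by (intro borel_measurable_continuous_onI linear_continuous_on matrix_vector_mul_bounded_linear)

text \<open>The volume of the preimage of the unit cube; for invertible \<open>A\<close> it turns
  out to be the reciprocal of the absolute determinant. An extended value keeps it meaningful before
  finiteness is known.\<close>

definition linear_volume_factor :: "real^'n^'n \<Rightarrow> ennreal" where
  "linear_volume_factor A = (\<integral>\<^sup>+x. indicator (cbox 0 One) (A *v x) \<partial>lborel)"

lemma nn_integral_unit_cube:
  "(\<integral>\<^sup>+x. indicator (cbox 0 One) x \<partial>(lborel :: 'a::euclidean_space measure)) = 1"
  by (simp add: emeasure_lborel_cbox_eq)

text \<open>Uniqueness of Haar measure: both sides of the identity equal the double integral of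
  \<open>f (A x) g y\<close>, evaluated after the shifts \<open>y \<mapsto> y - A x\<close> and \<open>x \<mapsto> x + B y\<close>.\<close>

lemma nn_integral_linear_swap:
  fixes A B :: "real^'n^'n" and f g :: "real^'n \<Rightarrow> ennreal"
  assumes [measurable]: "f \<in> borel_measurable borel" "g \<in> borel_measurable borel"
    and AB: "A ** B = mat 1"
  shows "(\<integral>\<^sup>+x. f (A *v x) \<partial>lborel) * (\<integral>\<^sup>+y. g y \<partial>lborel) =
    (\<integral>\<^sup>+x. g (- (A *v x)) \<partial>lborel) * (\<integral>\<^sup>+y. f y \<partial>lborel)"
proof -
  have ABv: "A *v (B *v y) = y" for y
    by (simp add: AB matrix_vector_mul_assoc)
  have "(\<integral>\<^sup>+x. f (A *v x) \<partial>lborel) * (\<integral>\<^sup>+y. g y \<partial>lborel) =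
      (\<integral>\<^sup>+x. f (A *v x) * (\<integral>\<^sup>+y. g (- (A *v x) + y) \<partial>lborel) \<partial>lborel)"
    by (simp only: nn_integral_lborel_translation assms) (simp add: nn_integral_multc)
  also have "\<dots> = (\<integral>\<^sup>+x. \<integral>\<^sup>+y. f (A *v x) * g (- (A *v x) + y) \<partial>lborel \<partial>lborel)"
    by (simp add: nn_integral_cmult)
  also have "\<dots> = (\<integral>\<^sup>+y. \<integral>\<^sup>+x. f (A *v x) * g (- (A *v x) + y) \<partial>lborel \<partial>lborel)"
    by (rule lborel_pair.Fubini') measurable
  also have "\<dots> = (\<integral>\<^sup>+y. \<integral>\<^sup>+x. f (A *v (B *v y + x)) * g (- (A *v (B *v y + x)) + y) \<partial>lborel \<partial>lborel)"
    by (intro nn_integral_cong nn_integral_lborel_translation[symmetric]) measurable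
  also have "\<dots> = (\<integral>\<^sup>+y. \<integral>\<^sup>+x. f (A *v x + y) * g (- (A *v x)) \<partial>lborel \<partial>lborel)"
    by (simp add: matrix_vector_right_distrib ABv add.commute)
  also have "\<dots> = (\<integral>\<^sup>+x. \<integral>\<^sup>+y. f (A *v x + y) * g (- (A *v x)) \<partial>lborel \<partial>lborel)"
    by (rule lborel_pair.Fubini') measurable
  also have "\<dots> = (\<integral>\<^sup>+x. (\<integral>\<^sup>+y. f (A *v x + y) \<partial>lborel) * g (- (A *v x)) \<partial>lborel)"
    by (simp add: nn_integral_multc)
  also have "\<dots> = (\<integral>\<^sup>+x. g (- (A *v x)) \<partial>lborel) * (\<integral>\<^sup>+y. f y \<partial>lborel)"
    by (simp only: nn_integral_lborel_translation assms) (simp add: nn_integral_cmult mult.commute)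
  finally show ?thesis .
qed

text \<open>With the unit cube indicator as \<open>g\<close>, the swap identity gives the claim up
  to a constant, the integral of \<open>g (- (A *v x))\<close>. Taking \<open>f = g\<close> as well
  shows that the reflection does not change this constant.\<close>

lemma nn_integral_linear_volume_factor:
  fixes A :: "real^'n^'n" and f :: "real^'n \<Rightarrow> ennreal"
  assumes [measurable]: "f \<in> borel_measurable borel" and "det A \<noteq> 0"
  shows "(\<integral>\<^sup>+x. f (A *v x) \<partial>lborel) = linear_volume_factor A * (\<integral>\<^sup>+x. f x \<partial>lborel)"
proof -
  obtain B where B: "A ** B = mat 1"
    using assms(2) by (metis invertible_det_nz invertible_right_inverse)
  define g :: "real^'n \<Rightarrow> ennreal" where "g = indicator (cbox 0 One)"
  have [measurable]: "g \<in> borel_measurable borel"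
    unfolding g_def by measurable
  have 1: "(\<integral>\<^sup>+x. g x \<partial>lborel) = 1"
    unfolding g_def by (rule nn_integral_unit_cube)
  have "(\<integral>\<^sup>+x. f (A *v x) \<partial>lborel) = (\<integral>\<^sup>+x. g (- (A *v x)) \<partial>lborel) * (\<integral>\<^sup>+y. f y \<partial>lborel)"
    using nn_integral_linear_swap[OF _ _ B, of f g] by (simp add: 1)
  moreover have "(\<integral>\<^sup>+x. g (- (A *v x)) \<partial>lborel) = linear_volume_factor A"
    using nn_integral_linear_swap[OF _ _ B, of g g]
    by (simp add: 1) (simp add: linear_volume_factor_def g_def)
  ultimately show ?thesis by simp
qed

lemma linear_volume_factor_mult:
  fixes A B :: "real^'n^'n"
  assumes "det A \<noteq> 0" "det B \<noteq> 0"
  shows "linear_volume_factor (A ** B) = linear_volume_factor A * linear_volume_factor B"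
proof -
  have "linear_volume_factor (A ** B) = (\<integral>\<^sup>+x. indicator (cbox 0 One) (A *v (B *v x)) \<partial>lborel)"
    by (simp add: linear_volume_factor_def matrix_vector_mul_assoc)
  also have "\<dots> = linear_volume_factor B * (\<integral>\<^sup>+x. indicator (cbox 0 One) (A *v x) \<partial>lborel)"
    by (rule nn_integral_linear_volume_factor) (use assms in measurable)
  finally show ?thesis
    by (simp add: linear_volume_factor_def mult.commute)
qed

lemma linear_volume_factor_id: "linear_volume_factor (mat 1 :: real^'n^'n) = 1"
  by (simp add: linear_volume_factor_def nn_integral_unit_cube)

text \<open>By multiplicativity the factors of \<open>A\<close> and its inverse have product 1, so
  neither is 0 or infinite. The real value \<open>c\<close> can then be cancelled in
  equations.\<close>

lemma linear_volume_factor_finite: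
  fixes A :: "real^'n^'n"
  assumes "det A \<noteq> 0"
  obtains c where "c > 0" "linear_volume_factor A = ennreal c"
proof -
  obtain B where B: "A ** B = mat 1"
    using assms(1) by (metis invertible_det_nz invertible_right_inverse)
  then have "det B \<noteq> 0"
    by (metis det_I det_mul mult_zero_right zero_neq_one)
  then have *: "linear_volume_factor A * linear_volume_factor B = 1"
    using linear_volume_factor_mult[OF assms, of B] by (simp add: B linear_volume_factor_id)
  then have "linear_volume_factor A \<noteq> 0" "linear_volume_factor A \<noteq> \<infinity>"
    by (auto simp: ennreal_top_mult split: if_splits)
  then show ?thesis
    using that by (cases "linear_volume_factor A") (auto simp: less_le)
qed

lemma linear_volume_factor_diagonal:
  fixes A :: "real^'n^'n"
  assumes diag: "\<And>i j. i \<noteq> j \<Longrightarrow> A$i$j = 0" and "det A \<noteq> 0"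
  shows "linear_volume_factor A * ennreal \<bar>det A\<bar> = 1"
proof -
  \<comment> \<open>The scaling theorem for Lebesgue measure indexes its factors by basis vectors;
    \<open>c\<close> sends the \<open>i\<close>-th one to the diagonal entry
    \<open>A$i$i\<close>.\<close>
  define c where "c b = (\<Sum>i\<in>UNIV. b$i * A$i$i)" for b :: "real^'n"
  have c_axis: "c (axis i 1) = A$i$i" for i
    by (simp add: c_def axis_def if_distrib[of "\<lambda>x. x * _"] cong: if_cong)
  have det: "det A = (\<Prod>i\<in>UNIV. A$i$i)"
    by (simp add: det_diagonal diag)
  have Basis: "(Basis :: (real^'n) set) = range (\<lambda>i. axis i 1)"
    by (auto simp: Basis_vec_def)
  have inj: "inj (\<lambda>i::'n. axis i (1::real))"
    by (auto simp: inj_on_def axis_eq_axis)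
  have prod: "(\<Prod>j\<in>Basis. \<bar>c j\<bar>) = \<bar>det A\<bar>"
    unfolding Basis by (simp add: prod.reindex[OF inj] c_axis det abs_prod)
  have c0: "c j \<noteq> 0" if "j \<in> Basis" for j
    using that assms(2) by (auto simp: det Basis c_axis)
  have Tv: "(\<Sum>j\<in>Basis. (c j * (x \<bullet> j)) *\<^sub>R j) = A *v x" for x
  proof -
    have "(A *v x) $ i = A$i$i * x$i" for i
      unfolding matrix_vector_mult_def
      by (simp, subst sum.remove[of _ i]) (auto intro!: sum.neutral simp: diag)
    then show ?thesis
      unfolding Basis
      by (simp add: sum.reindex[OF inj] c_axis vec_eq_iff inner_axis)
         (simp add: axis_def if_distrib[of "\<lambda>x. _ * x"] cong: if_cong)
  qed
  have "1 = (\<integral>\<^sup>+x. indicator (cbox 0 One) x \<partial>(lborel :: (real^'n) measure))"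
    by (rule nn_integral_unit_cube[symmetric])
  also have "\<dots> = (\<integral>\<^sup>+x. indicator (cbox 0 One) x \<partial>density (distr lborel borel ((*v) A)) (\<lambda>_. ennreal \<bar>det A\<bar>))"
    by (subst lborel_affine_euclidean[of c 0]) (auto simp: c0 Tv prod)
  also have "\<dots> = (\<integral>\<^sup>+x. ennreal \<bar>det A\<bar> * indicator (cbox 0 One) (A *v x) \<partial>lborel)"
    by (subst nn_integral_density) (auto intro!: nn_integral_distr)
  also have "\<dots> = linear_volume_factor A * ennreal \<bar>det A\<bar>"
    by (simp add: nn_integral_cmult linear_volume_factor_def mult.commute)
  finally show ?thesis ..
qed

text \<open>On the generators no integral has to be computed: a transposition \<open>W\<close> satisfies \<open>W\<^sup>2 = 1\<close>, and
  a shear \<open>S\<close> is conjugate to \<open>S\<^sup>2\<close> by a diagonal matrix, so multiplicativity forces the volume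
  factor and the absolute determinant to be 1.\<close>

lemma linear_volume_factor_det:
  fixes A :: "real^'n^'n"
  assumes "det A \<noteq> 0"
  shows "linear_volume_factor A * ennreal \<bar>det A\<bar> = 1"
proof -
  have "det A \<noteq> 0 \<longrightarrow> linear_volume_factor A * ennreal \<bar>det A\<bar> = 1"
  \<comment> \<open>The generators are matrices with a zero row, diagonal matrices, transpositions
    and shears. With \<open>det A \<noteq> 0\<close> kept inside the induction claim, the zero row
    case is vacuous and the factors of an invertible product are again covered.\<close>
  proof (induct A rule: induct_matrix_elementary_alt)
    case (1 A B)
    show ?case
    proof
      assume "det (A ** B) \<noteq> 0"
      then have nz: "det A \<noteq> 0" "det B \<noteq> 0"
        by (auto simp: det_mul)
      have "linear_volume_factor (A ** B) * ennreal \<bar>det (A ** B)\<bar> =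
          (linear_volume_factor A * ennreal \<bar>det A\<bar>) * (linear_volume_factor B * ennreal \<bar>det B\<bar>)"
        by (simp add: linear_volume_factor_mult nz det_mul abs_mult ennreal_mult mult_ac)
      then show "linear_volume_factor (A ** B) * ennreal \<bar>det (A ** B)\<bar> = 1"
        using 1 nz by simp
    qed
  next
    case (2 A i)
    then show ?case by (simp add: det_zero_row)
  next
    case (3 A)
    then show ?case by (simp add: linear_volume_factor_diagonal)
  next
    case (4 m n)
    define W :: "real^'n^'n" where "W = (\<chi> i j. mat 1 $ i $ Transposition.transpose m n j)"
    have "W $ i $ j = (if j = Transposition.transpose m n i then 1 else 0)" for i j
      by (auto simp: W_def mat_def)
    then have Wv: "W *v x = (\<chi> i. x $ Transposition.transpose m n i)" for x
      by (simp add: matrix_vector_mult_def vec_eq_iff if_distrib[of "\<lambda>x. x * _"] cong: if_cong)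
    have WW: "W ** W = mat 1"
      by (simp add: matrix_eq Wv vec_eq_iff flip: matrix_vector_mul_assoc)
    then have "det W * det W = 1"
      by (metis det_I det_mul)
    then have det: "\<bar>det W\<bar> = 1"
      by (auto simp: square_eq_1_iff)
    then have nz: "det W \<noteq> 0"
      by auto
    then obtain c where c: "c > 0" "linear_volume_factor W = ennreal c"
      by (rule linear_volume_factor_finite)
    have "ennreal (c * c) = 1"
      using linear_volume_factor_mult[OF nz nz] c by (simp add: WW linear_volume_factor_id ennreal_mult)
    then have "c * c = 1"
      using c by (simp add: ennreal_eq_1)
    then have "c = 1"
      using c by (auto simp: square_eq_1_iff)
    then show ?case
      using c det by (simp add: W_def)
  next
    case (5 m n)
    define S :: "real^'n^'n" where "S = (\<chi> i j. of_bool (i = m \<and> j = n \<or> i = j))"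
    define D :: "real^'n^'n" where "D = (\<chi> i j. if i = j then (if i = m then 2 else 1) else 0)"
    have "S $ i $ j = (if i = m \<and> j = n then 1 else 0) + (if i = j then 1 else 0)" for i j
      using 5 by (auto simp: S_def)
    then have Sv: "S *v x = (\<chi> i. (if i = m then x$n else 0) + x$i)" for x
      by (auto simp: matrix_vector_mult_def vec_eq_iff distrib_right sum.distrib
           if_distrib[of "\<lambda>x. x * _"] cong: if_cong)
    have Dv: "D *v x = (\<chi> i. (if i = m then 2 else 1) * x$i)" for x
      by (simp add: D_def matrix_vector_mult_def vec_eq_iff if_distrib[of "\<lambda>x. x * _"] cong: if_cong)
    \<comment> \<open>\<open>D\<close> doubles coordinate \<open>m\<close>; as
      \<open>m \<noteq> n\<close>, both sides send it to \<open>2 * x$m + 2 * x$n\<close> and fix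
      all others.\<close>
    have comm: "D ** S = S ** (S ** D)"
      using 5 by (simp add: matrix_eq Sv Dv vec_eq_iff flip: matrix_vector_mul_assoc)
    show ?case
    proof
      assume "det (\<chi> i j. of_bool (i = m \<and> j = n \<or> i = j) :: real^'n^'n) \<noteq> 0"
      then have S: "det S \<noteq> 0"
        by (simp add: S_def)
      have "det D = (\<Prod>i\<in>UNIV. D$i$i)"
        by (rule det_diagonal) (simp add: D_def)
      then have D: "det D \<noteq> 0"
        by (simp add: D_def)
      have "det D * det S = det S * (det S * det D)"
        by (metis comm det_mul)
      then have det: "det S = 1"
        using S D by simp
      obtain c where c: "c > 0" "linear_volume_factor S = ennreal c"
        using S by (rule linear_volume_factor_finite)
      obtain d where d: "d > 0" "linear_volume_factor D = ennreal d"
        using D by (rule linear_volume_factor_finite)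
      have "ennreal (d * c) = ennreal (c * (c * d))"
        using arg_cong[OF comm, of linear_volume_factor] S D c d
        by (simp add: linear_volume_factor_mult det_mul ennreal_mult)
      then have "d * c = c * (c * d)"
        using c d by simp
      then have "c = 1"
        using c d by simp
      then show "linear_volume_factor (\<chi> i j. of_bool (i = m \<and> j = n \<or> i = j) :: real^'n^'n) *
          ennreal \<bar>det (\<chi> i j. of_bool (i = m \<and> j = n \<or> i = j) :: real^'n^'n)\<bar> = 1"
        using c det by (simp add: S_def)
    qed
  qed
  then show ?thesis using assms by blast
qed

text \<open>HOL-Analysis has this change of variables only for index types that are well-ordered.\<close>

lemma nn_integral_lborel_linear:
  fixes A :: "real^'n^'n" and f :: "real^'n \<Rightarrow> ennreal"
  assumes "f \<in> borel_measurable borel" and "det A \<noteq> 0"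
  shows "(\<integral>\<^sup>+x. \<bar>det A\<bar> * f (A *v x) \<partial>lborel) = (\<integral>\<^sup>+x. f x \<partial>lborel)"
proof -
  have "(\<integral>\<^sup>+x. \<bar>det A\<bar> * f (A *v x) \<partial>lborel) =
      (linear_volume_factor A * ennreal \<bar>det A\<bar>) * (\<integral>\<^sup>+x. f x \<partial>lborel)"
    using assms by (simp add: nn_integral_cmult nn_integral_linear_volume_factor mult_ac)
  then show ?thesis
    by (simp add: linear_volume_factor_det assms)
qed

subsection \<open>Gaussian measures\<close>

lemma positive_definite_orthonormal_basis:
  fixes C :: "real^'n^'n"
  assumes C: "positive_definite C"
  obtains v :: "'n \<Rightarrow> real^'n" where "\<And>i j. v i \<bullet> (C *v v j) = of_bool (i = j)"
proof -
  have sym: "x \<bullet> (C *v y) = y \<bullet> (C *v x)" for x y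
    using C by (metis dot_lmul_matrix inner_commute positive_definite_def transpose_matrix_vector)
  \<comment> \<open>Gram-Schmidt for the inner product \<open>x \<bullet> (C *v y)\<close>, by
    induction on the set of indices already served.\<close>
  have "\<exists>v :: 'n \<Rightarrow> real^'n. \<forall>i\<in>I. \<forall>j\<in>I. v i \<bullet> (C *v v j) = of_bool (i = j)" for I :: "'n set"
    using finite[of I]
  proof (induct I rule: finite_induct)
    case empty
    then show ?case by simp
  next
    case (insert k F)
    then obtain v :: "'n \<Rightarrow> real^'n"
      where v: "\<And>i j. i \<in> F \<Longrightarrow> j \<in> F \<Longrightarrow> v i \<bullet> (C *v v j) = of_bool (i = j)"
      by auto
    \<comment> \<open>Orthogonality to \<open>v i\<close> in this inner product is Euclidean
      orthogonality to \<open>C *v v i\<close>. These vectors span too few dimensions because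
      \<open>k\<close> lies outside \<open>F\<close>, so a nonzero \<open>w\<close> exists and only
      needs normalising.\<close>
    let ?V = "(\<lambda>i. C *v v i) ` F"
    have "dim ?V \<le> card ?V"
      by (rule dim_le_card') (use insert in simp)
    also have "\<dots> \<le> card F"
      by (rule card_image_le) (use insert in simp)
    also have "\<dots> < CARD('n)"
      using insert by (intro psubset_card_mono) auto
    finally have "dim ?V < DIM(real^'n)"
      by simp
    then obtain w where w: "w \<noteq> 0" "\<And>y. y \<in> span ?V \<Longrightarrow> orthogonal w y"
      by (rule orthogonal_to_subspace_exists) blast
    have pos: "w \<bullet> (C *v w) > 0"
      using C w by (simp add: positive_definite_def)
    have wF: "w \<bullet> (C *v v i) = 0" if "i \<in> F" for i
      using w(2)[of "C *v v i"] that by (simp add: orthogonal_def span_base)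
    define u where "u = (1 / sqrt (w \<bullet> (C *v w))) *\<^sub>R w"
    have uu: "u \<bullet> (C *v u) = 1"
      using pos by (simp add: u_def matrix_vector_mult_scaleR field_simps)
    have uF: "u \<bullet> (C *v v i) = 0" "v i \<bullet> (C *v u) = 0" if "i \<in> F" for i
      using wF[OF that] sym[of u "v i"] by (simp_all add: u_def)
    show ?case
      by (rule exI[of _ "v(k := u)"]) (use v uu uF insert in auto)
  qed
  from this[of UNIV] show ?thesis
    using that by auto
qed

lemma positive_definite_congruent_id:
  fixes C :: "real^'n^'n"
  assumes "positive_definite C"
  obtains U :: "real^'n^'n" where "transpose U ** C ** U = mat 1"
proof -
  obtain v :: "'n \<Rightarrow> real^'n" where v: "\<And>i j. v i \<bullet> (C *v v j) = of_bool (i = j)"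
    using positive_definite_orthonormal_basis[OF assms] by blast
  \<comment> \<open>The columns of \<open>U\<close> are the vectors \<open>v i\<close>, so the
    congruent matrix is their Gram matrix for \<open>C\<close>.\<close>
  define U where "U = transpose (\<chi> i. v i)"
  have "(transpose U ** (C ** U)) $ i $ j = v i \<bullet> (C *v v j)" for i j
    by (simp add: U_def matrix_matrix_mult_def matrix_vector_mult_def inner_vec_def transpose_def)
  then have "transpose U ** (C ** U) = mat 1"
    by (simp add: v vec_eq_iff mat_def)
  then show ?thesis
    using that by (simp add: matrix_mul_assoc)
qed

section \<open>Mass and second moment of isotropic Gaussians\<close>

lemma nn_integral_isotropic_gaussian:
  fixes \<sigma> :: real
  assumes "\<sigma> > 0"
  shows "(\<integral>\<^sup>+x. exp (- (norm (x :: 'a::euclidean_space))\<^sup>2 / (2 * \<sigma>\<^sup>2)) / sqrt (2 * pi * \<sigma>\<^sup>2) ^ DIM('a) \<partial>lborel) = 1"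
proof -
  \<comment> \<open>The density is a product of one-dimensional normal densities, one per basis
    vector, so the integral is a product of integrals over the line.\<close>
  have "exp (- (norm (x::'a))\<^sup>2 / (2 * \<sigma>\<^sup>2)) / sqrt (2 * pi * \<sigma>\<^sup>2) ^ DIM('a) =
      (\<Prod>b\<in>Basis. normal_density 0 \<sigma> (x \<bullet> b))" for x
  proof -
    have "(norm x)\<^sup>2 = (\<Sum>b\<in>Basis. (x \<bullet> b)\<^sup>2)"
      by (subst power2_norm_eq_inner, subst euclidean_inner) (simp add: power2_eq_square)
    then have "exp (- (norm x)\<^sup>2 / (2 * \<sigma>\<^sup>2)) = (\<Prod>b\<in>Basis. exp (- (x \<bullet> b)\<^sup>2 / (2 * \<sigma>\<^sup>2)))"
      by (simp add: exp_sum[symmetric] sum_negf sum_divide_distrib)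
    then show ?thesis
      by (simp add: normal_density_def prod_dividef power_divide power_one_over)
  qed
  then have "(\<integral>\<^sup>+x. exp (- (norm (x :: 'a::euclidean_space))\<^sup>2 / (2 * \<sigma>\<^sup>2)) / sqrt (2 * pi * \<sigma>\<^sup>2) ^ DIM('a) \<partial>lborel)
      = (\<integral>\<^sup>+x. (\<Prod>b\<in>Basis. ennreal (normal_density 0 \<sigma> ((x::'a) \<bullet> b))) \<partial>lborel)"
    by (simp add: prod_ennreal)
  also have "\<dots> = (\<Prod>b\<in>(Basis::'a set). (\<integral>\<^sup>+x. ennreal (normal_density 0 \<sigma> x) \<partial>lborel))"
    by (rule nn_integral_lborel_prod) auto
  also have "(\<integral>\<^sup>+x. ennreal (normal_density 0 \<sigma> x) \<partial>lborel) = 1"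
    using assms by (subst nn_integral_eq_integral) (auto simp: integral_normal_density)
  finally show ?thesis by simp
qed

text \<open>Half of the exponent absorbs the factor \<open>(norm x)\<^sup>2\<close>: the integrand
  is at most a constant times the Gaussian density of variance 2, which has mass 1.\<close>

lemma nn_integral_norm_square_gaussian_finite:
  "(\<integral>\<^sup>+x. (norm (x :: 'a::euclidean_space))\<^sup>2 * (exp (- (norm x)\<^sup>2 / 2) / sqrt (2 * pi) ^ DIM('a)) \<partial>lborel) < \<infinity>"
proof -
  \<comment> \<open>The 4 comes from \<open>t \<le> exp t\<close> at
    \<open>t = (norm x)\<^sup>2 / 4\<close>; the quotient exchanges the normalisations of variances
    2 and 1.\<close>
  define K where "K = 4 * sqrt (2 * pi * (sqrt 2)\<^sup>2) ^ DIM('a) / sqrt (2 * pi) ^ DIM('a)"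
  have K: "K \<ge> 0"
    by (simp add: K_def)
  have "(norm x)\<^sup>2 * (exp (- (norm x)\<^sup>2 / 2) / sqrt (2 * pi) ^ DIM('a)) \<le>
      K * (exp (- (norm x)\<^sup>2 / (2 * (sqrt 2)\<^sup>2)) / sqrt (2 * pi * (sqrt 2)\<^sup>2) ^ DIM('a))" for x :: 'a
  proof -
    define t where "t = (norm x)\<^sup>2 / 4"
    have "4 * t \<le> 4 * exp t"
      using exp_ge_add_one_self[of t] by linarith
    then have "(norm x)\<^sup>2 * exp (- (norm x)\<^sup>2 / 2) \<le> 4 * exp t * exp (- (norm x)\<^sup>2 / 2)"
      by (intro mult_right_mono) (auto simp: t_def)
    also have "\<dots> = 4 * exp (- (norm x)\<^sup>2 / 4)"
      by (simp add: t_def exp_add[symmetric] field_simps)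
    finally have "(norm x)\<^sup>2 * exp (- (norm x)\<^sup>2 / 2) / sqrt (2 * pi) ^ DIM('a) \<le>
        4 * exp (- (norm x)\<^sup>2 / 4) / sqrt (2 * pi) ^ DIM('a)"
      by (rule divide_right_mono) simp
    then show ?thesis
      by (simp add: K_def)
  qed
  then have "(\<integral>\<^sup>+x. (norm (x :: 'a))\<^sup>2 * (exp (- (norm x)\<^sup>2 / 2) / sqrt (2 * pi) ^ DIM('a)) \<partial>lborel) \<le>
      (\<integral>\<^sup>+x. ennreal K * ennreal (exp (- (norm (x::'a))\<^sup>2 / (2 * (sqrt 2)\<^sup>2)) / sqrt (2 * pi * (sqrt 2)\<^sup>2) ^ DIM('a)) \<partial>lborel)"
    by (intro nn_integral_mono) (simp only: ennreal_mult'[OF K, symmetric] ennreal_leI)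
  also have "\<dots> = ennreal K"
    by (subst nn_integral_cmult) (simp_all only: nn_integral_isotropic_gaussian real_sqrt_gt_zero zero_less_numeral mult_1_right, measurable)
  finally show ?thesis
    by (simp add: le_less_trans)
qed

text \<open>Whitening: for \<open>U\<^sup>T C U = 1\<close> the map \<open>y = U\<^sup>T x\<close> takes the density of \<open>gaussian 0 C\<close> to the
  standard Gaussian density, because \<open>C\<^sup>-\<^sup>1 = U U\<^sup>T\<close> and \<open>det C = (det U)\<^sup>-\<^sup>2\<close>.\<close>

lemma gaussian_whitening:
  fixes C :: "real^'n^'n"
  assumes "positive_definite C"
  obtains A :: "real^'n^'n" where "det A \<noteq> 0"
    "\<And>m. gaussian m C = density lborel (\<lambda>x.
       ennreal (\<bar>det A\<bar> * (exp (- (norm (A *v (x - m)))\<^sup>2 / 2) / sqrt (2 * pi) ^ CARD('n))))"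
proof -
  obtain U :: "real^'n^'n" where U: "transpose U ** C ** U = mat 1"
    using positive_definite_congruent_id[OF assms] .
  have "det U * det C * det U = 1"
    using arg_cong[OF U, of det] by (simp add: det_mul)
  then have dU: "det U \<noteq> 0" and dC: "det C = 1 / (det U)\<^sup>2"
    by (auto simp: power2_eq_square eq_divide_eq mult_ac)
  have inv1: "C ** (U ** transpose U) = mat 1"
    using U by (metis matrix_left_right_inverse matrix_mul_assoc)
  then have inv2: "(U ** transpose U) ** C = mat 1"
    by (simp add: matrix_left_right_inverse)
  have "C ** matrix_inv C = mat 1 \<and> matrix_inv C ** C = mat 1"
    unfolding matrix_inv_def by (rule someI2[of _ "U ** transpose U"]) (use inv1 inv2 in auto)
  then have inv: "matrix_inv C = U ** transpose U"
    using inv1 inv2 by (metis matrix_mul_assoc matrix_mul_lid matrix_mul_rid)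
  have quad: "y \<bullet> (matrix_inv C *v y) = (norm (transpose U *v y))\<^sup>2" for y
  proof -
    have "y \<bullet> (U *v (transpose U *v y)) = (transpose U *v y) \<bullet> (transpose U *v y)"
      by (simp add: dot_lmul_matrix[symmetric])
    then show ?thesis
      by (simp only: inv matrix_vector_mul_assoc[symmetric] power2_norm_eq_inner)
  qed
  have "sqrt ((2 * pi) ^ CARD('n) * det C) = sqrt (2 * pi) ^ CARD('n) / \<bar>det U\<bar>"
    by (simp only: dC real_sqrt_mult real_sqrt_power[symmetric] real_sqrt_divide real_sqrt_abs real_sqrt_one)
       (simp add: real_sqrt_power real_sqrt_mult power_mult_distrib)
  then have "gaussian m C = density lborel (\<lambda>x. ennreal
      (\<bar>det (transpose U)\<bar> * (exp (- (norm (transpose U *v (x - m)))\<^sup>2 / 2) / sqrt (2 * pi) ^ CARD('n))))" for m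
    by (simp only: gaussian_def quad det_transpose) (simp add: field_simps)
  then show ?thesis
    using dU by (intro that[of "transpose U"]) auto
qed

section \<open>Translation, mass and moments of general Gaussians\<close>

lemma sets_gaussian [simp, measurable_cong]: "sets (gaussian m C) = sets borel"
  by (simp add: gaussian_def)

lemma space_gaussian [simp]: "space (gaussian m C) = UNIV"
  by (simp add: gaussian_def)

text \<open>Translation invariance of Lebesgue measure. It separates mean from noise, so that
  perturbing the mean becomes shifting the action under one fixed law.\<close>

lemma gaussian_eq_distr:
  fixes C :: "real^'n^'n"
  shows "gaussian m C = distr (gaussian 0 C) borel (\<lambda>z. m + z)"
proof -
  define f :: "real^'n \<Rightarrow> ennreal" where "f x = ennreal
     (exp (- ((x - m) \<bullet> (matrix_inv C *v (x - m))) / 2) / sqrt ((2 * pi) ^ CARD('n) * det C))" for x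
  have [measurable]: "f \<in> borel_measurable borel"
    unfolding f_def by measurable
  have "gaussian m C = density (distr lborel borel ((+) m)) f"
    by (simp add: gaussian_def f_def[abs_def] lborel_distr_plus)
  also have "\<dots> = distr (density lborel (\<lambda>x. f (m + x))) borel ((+) m)"
    by (rule density_distr) auto
  finally show ?thesis
    by (simp add: gaussian_def f_def[abs_def])
qed

lemma prob_space_gaussian:
  fixes C :: "real^'n^'n"
  assumes "positive_definite C"
  shows "prob_space (gaussian m C)"
proof -
  obtain A :: "real^'n^'n" where A: "det A \<noteq> 0"
    "\<And>m. gaussian m C = density lborel (\<lambda>x.
       ennreal (\<bar>det A\<bar> * (exp (- (norm (A *v (x - m)))\<^sup>2 / 2) / sqrt (2 * pi) ^ CARD('n))))"
    using gaussian_whitening[OF assms] by blast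
  \<comment> \<open>The whitened density already carries the factor
    \<open>\<bar>det A\<bar>\<close>, so the linear change of variables leaves the mass of the
    standard Gaussian.\<close>
  have "emeasure (gaussian 0 C) UNIV =
     (\<integral>\<^sup>+x. \<bar>det A\<bar> * ennreal (exp (- (norm (A *v x))\<^sup>2 / 2) / sqrt (2 * pi) ^ CARD('n)) \<partial>lborel)"
    unfolding A(2) by (subst emeasure_density) (auto simp flip: ennreal_mult')
  also have "\<dots> = (\<integral>\<^sup>+x. ennreal (exp (- (norm (x::real^'n))\<^sup>2 / 2) / sqrt (2 * pi) ^ CARD('n)) \<partial>lborel)"
    using A(1) by (intro nn_integral_lborel_linear) auto
  also have "\<dots> = 1"
    using nn_integral_isotropic_gaussian[of 1, where 'a="real^'n"] by simp
  finally have "prob_space (gaussian 0 C)"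
    by (intro prob_spaceI) simp
  then show ?thesis
    by (subst gaussian_eq_distr) (auto intro!: prob_space.prob_space_distr)
qed

text \<open>The inverse of the whitening map is bounded, so \<open>(norm x)\<^sup>2\<close> is at
  most a constant times \<open>(norm (A *v x))\<^sup>2\<close>; the change of variables then leaves
  the second moment of the standard Gaussian.\<close>

lemma integrable_gaussian_norm_square:
  fixes C :: "real^'n^'n"
  assumes "positive_definite C"
  shows "integrable (gaussian 0 C) (\<lambda>z. (norm z)\<^sup>2)"
proof -
  obtain A :: "real^'n^'n" where A: "det A \<noteq> 0"
    "\<And>m. gaussian m C = density lborel (\<lambda>x.
       ennreal (\<bar>det A\<bar> * (exp (- (norm (A *v (x - m)))\<^sup>2 / 2) / sqrt (2 * pi) ^ CARD('n))))"
    using gaussian_whitening[OF assms] by blast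
  define p :: "real^'n \<Rightarrow> real" where "p x = exp (- (norm x)\<^sup>2 / 2) / sqrt (2 * pi) ^ CARD('n)" for x
  have p0: "p x \<ge> 0" for x
    by (simp add: p_def)
  have [measurable]: "p \<in> borel_measurable borel"
    unfolding p_def by measurable
  obtain B where B: "B ** A = mat 1"
    using A(1) by (metis invertible_det_nz invertible_left_inverse)
  define M where "M = (onorm ((*v) B))\<^sup>2"
  have bound: "(norm x)\<^sup>2 \<le> M * (norm (A *v x))\<^sup>2" for x
  proof -
    have "norm (B *v (A *v x)) \<le> onorm ((*v) B) * norm (A *v x)"
      by (rule onorm) (rule matrix_vector_mul_bounded_linear)
    then have "norm x \<le> onorm ((*v) B) * norm (A *v x)"
      by (simp add: matrix_vector_mul_assoc B)
    then show ?thesis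
      by (simp add: M_def power_mono flip: power_mult_distrib)
  qed
  have "(\<integral>\<^sup>+z. (norm z)\<^sup>2 \<partial>gaussian 0 C) =
     (\<integral>\<^sup>+x. ennreal (\<bar>det A\<bar> * p (A *v x)) * ennreal ((norm x)\<^sup>2) \<partial>lborel)"
    unfolding A(2) p_def by (subst nn_integral_density) auto
  also have "\<dots> \<le> (\<integral>\<^sup>+x. \<bar>det A\<bar> * ennreal (M * ((norm (A *v x))\<^sup>2 * p (A *v x))) \<partial>lborel)"
  proof (intro nn_integral_mono)
    fix x
    have "p (A *v x) * (norm x)\<^sup>2 \<le> p (A *v x) * (M * (norm (A *v x))\<^sup>2)"
      using bound p0 by (intro mult_left_mono) auto
    then have "\<bar>det A\<bar> * p (A *v x) * (norm x)\<^sup>2 \<le> \<bar>det A\<bar> * (M * ((norm (A *v x))\<^sup>2 * p (A *v x)))"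
      by (subst mult.assoc, intro mult_left_mono) (simp_all add: mult_ac)
    then show "ennreal (\<bar>det A\<bar> * p (A *v x)) * ennreal ((norm x)\<^sup>2) \<le>
        \<bar>det A\<bar> * ennreal (M * ((norm (A *v x))\<^sup>2 * p (A *v x)))"
      by (simp add: p0 ennreal_leI flip: ennreal_mult')
  qed
  also have "\<dots> = (\<integral>\<^sup>+x. ennreal (M * ((norm x)\<^sup>2 * p x)) \<partial>lborel)"
    using A(1) by (intro nn_integral_lborel_linear) auto
  also have "\<dots> = ennreal M * (\<integral>\<^sup>+x. ennreal ((norm x)\<^sup>2 * p x) \<partial>lborel)"
    by (subst nn_integral_cmult[symmetric]) (auto simp: M_def ennreal_mult')
  also have "\<dots> < \<infinity>"
    using nn_integral_norm_square_gaussian_finite[where 'a="real^'n"]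
    by (simp add: p_def ennreal_mult_less_top)
  finally show ?thesis
    by (intro integrableI_bounded) auto
qed

lemma integrable_gaussian_norm:
  fixes C :: "real^'n^'n"
  assumes "positive_definite C"
  shows "integrable (gaussian 0 C) norm"
proof -
  interpret prob_space "gaussian 0 C"
    by (rule prob_space_gaussian[OF assms])
  show ?thesis
    by (rule square_integrable_imp_integrable) (auto intro: integrable_gaussian_norm_square[OF assms])
qed

subsection \<open>Functions with Lipschitz gradient\<close>

text \<open>\<open>grad\<close> is a definite description and denotes the gradient only once
  existence and uniqueness are shown. Existence is Riesz representation in coordinates; uniqueness
  is that of derivatives.\<close>

lemma has_derivative_grad:
  fixes f :: "real^'n \<Rightarrow> real"
  assumes "f differentiable (at a)"
  shows "(f has_derivative (\<lambda>h. h \<bullet> grad f a)) (at a)"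
proof -
  obtain f' where f': "(f has_derivative f') (at a)"
    using assms by (auto simp: differentiable_def)
  define D where "D = (\<Sum>b\<in>Basis. f' b *\<^sub>R b)"
  have "f' h = h \<bullet> D" for h
  proof -
    have "f' h = f' (\<Sum>b\<in>Basis. (h \<bullet> b) *\<^sub>R b)"
      by (simp add: euclidean_representation)
    also have "\<dots> = (\<Sum>b\<in>Basis. (h \<bullet> b) * f' b)"
      using has_derivative_linear[OF f'] by (simp add: linear_sum linear_scale)
    finally show ?thesis
      by (simp add: D_def inner_sum_right mult.commute)
  qed
  then have D: "GDERIV f a :> D"
    using f' unfolding gderiv_def by (metis (no_types, lifting) ext)
  have "grad f a = D"
    unfolding grad_def
  proof (rule the_equality)
    fix D' assume "GDERIV f a :> D'"
    then have "(\<lambda>h. h \<bullet> D') = (\<lambda>h. h \<bullet> D)"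
      using D has_derivative_unique unfolding gderiv_def by blast
    then show "D' = D"
      by (metis vector_eq_ldot)
  qed (rule D)
  then show ?thesis
    using D by (simp add: gderiv_def)
qed

section \<open>Descent inequality and its average over the noise\<close>

locale lipschitz_gradient =
  fixes f :: "'a::euclidean_space \<Rightarrow> real" and g :: "'a \<Rightarrow> 'a" and \<beta> :: real
  assumes deriv: "(f has_derivative (\<lambda>h. h \<bullet> g a)) (at a)"
    and lipschitz: "norm (g a - g b) \<le> \<beta> * norm (a - b)"
    and beta_nonneg: "\<beta> \<ge> 0"
begin

text \<open>The hypotheses survive a change of sign, so the lower quadratic bound is the upper one
  for \<open>- f\<close>.\<close>

lemma uminus: "lipschitz_gradient (\<lambda>x. - f x) (\<lambda>x. - g x) \<beta>"
proof
  show "((\<lambda>x. - f x) has_derivative (\<lambda>h. h \<bullet> - g a)) (at a)" for a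
    using has_derivative_minus[OF deriv[of a]] by simp
  show "norm (- g a - - g b) \<le> \<beta> * norm (a - b)" for a b
    using lipschitz[of a b] by (simp add: norm_minus_commute)
qed (rule beta_nonneg)

lemma borel_measurable: "f \<in> borel_measurable borel"
  by (intro borel_measurable_continuous_onI continuous_at_imp_continuous_on ballI
      has_derivative_continuous[OF deriv])

lemma upper_bound: "f (a + h) \<le> f a + h \<bullet> g a + \<beta> / 2 * (norm h)\<^sup>2"
proof -
  \<comment> \<open>\<open>F\<close> is \<open>f\<close> along the segment from \<open>a\<close> to
    \<open>a + h\<close> minus the claimed first and second order terms. The claim is
    \<open>F 1 \<le> F 0\<close>, and the Lipschitz gradient makes the derivative of
    \<open>F\<close> nonpositive.\<close>
  define F where "F t = f (a + t *\<^sub>R h) - t * (h \<bullet> g a) - \<beta> / 2 * t\<^sup>2 * (norm h)\<^sup>2" for t :: real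
  have "F 1 \<le> F 0"
  proof (rule DERIV_nonpos_imp_nonincreasing[of 0 1 F])
    fix t :: real assume t: "0 \<le> t" "t \<le> 1"
    have "((\<lambda>t. f (a + t *\<^sub>R h)) has_derivative (\<lambda>s. (s *\<^sub>R h) \<bullet> g (a + t *\<^sub>R h))) (at t)"
      by (rule has_derivative_compose[of _ _ _ _ f, OF _ deriv]) (auto intro!: derivative_eq_intros)
    then have "((\<lambda>t. f (a + t *\<^sub>R h)) has_real_derivative h \<bullet> g (a + t *\<^sub>R h)) (at t)"
      by (simp add: has_field_derivative_def mult.commute[of _ "h \<bullet> g (a + t *\<^sub>R h)"])
    then have "(F has_real_derivative h \<bullet> g (a + t *\<^sub>R h) - h \<bullet> g a - \<beta> * t * (norm h)\<^sup>2) (at t)"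
      unfolding F_def by (auto intro!: derivative_eq_intros)
    moreover have "h \<bullet> g (a + t *\<^sub>R h) - h \<bullet> g a \<le> \<beta> * t * (norm h)\<^sup>2"
    proof -
      have "h \<bullet> g (a + t *\<^sub>R h) - h \<bullet> g a = h \<bullet> (g (a + t *\<^sub>R h) - g a)"
        by (simp add: inner_diff_right)
      also have "\<dots> \<le> norm h * norm (g (a + t *\<^sub>R h) - g a)"
        by (rule norm_cauchy_schwarz)
      also have "\<dots> \<le> norm h * (\<beta> * norm (a + t *\<^sub>R h - a))"
        by (intro mult_left_mono lipschitz) simp
      finally show ?thesis
        using t by (simp add: power2_eq_square mult_ac)
    qed
    ultimately show "\<exists>y. (F has_real_derivative y) (at t) \<and> y \<le> 0"
      by force
  qed simp
  then show ?thesis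
    by (simp add: F_def)
qed

lemma lower_bound: "f (a + h) \<ge> f a + h \<bullet> g a - \<beta> / 2 * (norm h)\<^sup>2"
  using lipschitz_gradient.upper_bound[OF uminus, of a h] by simp

lemma abs_bound: "\<bar>f (a + h)\<bar> \<le> \<bar>f a\<bar> + norm (g a) * norm h + \<beta> / 2 * (norm h)\<^sup>2"
  using upper_bound[of a h] lower_bound[of a h] Cauchy_Schwarz_ineq2[of h "g a"]
  by (simp add: abs_le_iff mult.commute) linarith

text \<open>By \<open>abs_bound\<close> the growth is at most quadratic, so two finite moments give
  an integrable majorant.\<close>

lemma integrable_shift:
  assumes "prob_space M" and sets: "sets M = sets borel"
    and "integrable M norm" "integrable M (\<lambda>z. (norm z)\<^sup>2)"
  shows "integrable M (\<lambda>z. f (a + z))"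
proof -
  interpret prob_space M by fact
  note [measurable] = borel_measurable
  note [measurable_cong] = sets
  show ?thesis
  proof (rule Bochner_Integration.integrable_bound)
    show "integrable M (\<lambda>z. \<bar>f a\<bar> + norm (g a) * norm z + \<beta> / 2 * (norm z)\<^sup>2)"
      using assms(3,4) by simp
    show "AE z in M. norm (f (a + z)) \<le> norm (\<bar>f a\<bar> + norm (g a) * norm z + \<beta> / 2 * (norm z)\<^sup>2)"
      using abs_bound[of a] by (auto intro!: AE_I2 order_trans[OF _ abs_ge_self])
  qed measurable
qed

text \<open>Test the robustness inequality against a step of length \<open>D\<close> in the direction of steepest
  descent at the centre \<open>a\<close>.\<close>

lemma gradient_bound:
  assumes "prob_space M" and sets: "sets M = sets borel"
    and norm: "integrable M norm" and norm2: "integrable M (\<lambda>z. (norm z)\<^sup>2)"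
    and "D > 0"
    and robust: "\<And>h. norm h \<le> D \<Longrightarrow> (LINT z|M. f (a + z)) - (LINT z|M. f (a + z + h)) \<le> L"
  shows "norm (g a) \<le> L / D + \<beta> / 2 * D + \<beta> * (LINT z|M. norm z)"
proof -
  interpret prob_space M by fact
  \<comment> \<open>As \<open>sgn 0 = 0\<close>, a vanishing gradient gives the zero step; in either
    case \<open>norm h \<le> D\<close> and
    \<open>h \<bullet> g a = - (D * norm (g a))\<close>.\<close>
  define h where "h = - (D *\<^sub>R sgn (g a))"
  have h: "norm h \<le> D"
    using \<open>D > 0\<close> by (simp add: h_def norm_sgn)
  have ha: "h \<bullet> g a = - (D * norm (g a))"
    by (cases "g a = 0")
       (simp_all add: h_def sgn_div_norm power2_norm_eq_inner[symmetric] power2_eq_square)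
  note int = integrable_shift[OF assms(1-4)]
  have int': "integrable M (\<lambda>z. f (a + z + h))"
    using int[of "a + h"] by (simp add: add_ac)
  \<comment> \<open>The descent inequality starts at \<open>a + z\<close>. Passing from
    \<open>g (a + z)\<close> to \<open>g a\<close> costs at most
    \<open>\<beta> * D * norm z\<close>, which is the origin of the summand with the mean
    noise.\<close>
  have "D * norm (g a) - \<beta> * D * norm z - \<beta> / 2 * D\<^sup>2 \<le> f (a + z) - f (a + z + h)" for z
  proof -
    have "h \<bullet> (g (a + z) - g a) \<le> norm h * norm (g (a + z) - g a)"
      by (rule norm_cauchy_schwarz)
    also have "\<dots> \<le> D * (\<beta> * norm z)"
      using h lipschitz[of "a + z" a] \<open>D > 0\<close> by (intro mult_mono) auto
    finally have "h \<bullet> g (a + z) \<le> \<beta> * D * norm z - D * norm (g a)"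
      by (simp add: inner_diff_right ha mult_ac)
    moreover have "\<beta> / 2 * (norm h)\<^sup>2 \<le> \<beta> / 2 * D\<^sup>2"
      using h beta_nonneg by (intro mult_left_mono power_mono) auto
    ultimately show ?thesis
      using upper_bound[of "a + z" h] by linarith
  qed
  then have "(LINT z|M. D * norm (g a) - \<beta> * D * norm z - \<beta> / 2 * D\<^sup>2) \<le>
      (LINT z|M. f (a + z) - f (a + z + h))"
    using int int' norm by (intro integral_mono) auto
  also have "\<dots> \<le> L"
    using robust[OF h] int int' by simp
  finally have "D * norm (g a) - \<beta> * D * (LINT z|M. norm z) - \<beta> / 2 * D\<^sup>2 \<le> L"
    using norm by (simp add: prob_space)
  then show ?thesis
    using \<open>D > 0\<close> by (simp add: field_simps power2_eq_square)
qed

text \<open>On the ball the gradient differs from its value at the centre by at most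
  \<open>\<beta> * r\<close>, hence has norm at most \<open>G + \<beta> * r\<close>. The ball is
  convex, so the mean value inequality applies.\<close>

lemma lipschitz_near:
  assumes G: "norm (g m) \<le> G" and "norm (a - m) \<le> r" "norm (b - m) \<le> r"
  shows "\<bar>f a - f b\<bar> \<le> (G + \<beta> * r) * norm (a - b)"
proof -
  have "norm (f a - f b) \<le> (G + \<beta> * r) * norm (a - b)"
  proof (rule differentiable_bound[of "cball m r" f "\<lambda>x h. h \<bullet> g x"])
    show "(f has_derivative (\<lambda>h. h \<bullet> g x)) (at x within cball m r)" for x
      by (rule has_derivative_at_withinI[OF deriv])
    show "onorm (\<lambda>h. h \<bullet> g x) \<le> G + \<beta> * r" if "x \<in> cball m r" for x
    proof (rule onorm_le)
      fix h :: 'a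
      have "norm (g x) \<le> norm (g m) + norm (g x - g m)"
        by (rule norm_triangle_sub)
      also have "norm (g x - g m) \<le> \<beta> * norm (x - m)"
        by (rule lipschitz)
      also have "\<dots> \<le> \<beta> * r"
        using that beta_nonneg by (intro mult_left_mono) (auto simp: dist_norm norm_minus_commute)
      finally have "norm (g x) \<le> G + \<beta> * r"
        using G by simp
      then have "norm h * norm (g x) \<le> norm h * (G + \<beta> * r)"
        by (rule mult_left_mono) simp
      then show "norm (h \<bullet> g x) \<le> (G + \<beta> * r) * norm h"
        using Cauchy_Schwarz_ineq2[of h "g x"] by (simp add: mult.commute)
    qed
  qed (use assms in \<open>auto simp: dist_norm norm_minus_commute\<close>)
  then show ?thesis by simp
qed

end

lemma beta_smooth_lipschitz_gradient:
  assumes "beta_smooth S \<beta> R" "s \<in> S" "\<beta> \<ge> 0"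
  shows "lipschitz_gradient (R s) (grad (R s)) \<beta>"
  using assms by unfold_locales (auto simp: beta_smooth_def intro: has_derivative_grad)

subsection \<open>Flatness and action robustness\<close>

lemma integral_gaussian_shift:
  fixes f :: "real^'n \<Rightarrow> real"
  assumes [measurable]: "f \<in> borel_measurable borel"
  shows "(LINT a|gaussian m C. f a) = (LINT z|gaussian 0 C. f (m + z))"
  by (subst gaussian_eq_distr, rule integral_distr) measurable

text \<open>Full row rank gives the Jacobian a linear right inverse. Sussmann's open mapping
  theorem, which asks for continuity near \<open>\<phi>\<close> and differentiability at
  \<open>\<phi>\<close>, then places a ball around the mean inside the image of the
  \<open>E\<close>-ball.\<close>

lemma induced_radius_point:
  fixes \<mu> :: "real^'m \<Rightarrow> 's \<Rightarrow> real^'n"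
  assumes "E > 0" and cont: "continuous_on (cball \<phi> E) (\<lambda>\<psi>. \<mu> \<psi> s)"
    and diff: "(\<lambda>\<psi>. \<mu> \<psi> s) differentiable (at \<phi>)"
    and rank: "rank (jacobian (\<lambda>\<psi>. \<mu> \<psi> s) (at \<phi>)) = CARD('n)"
  obtains D where "D > 0" "induced_radius {s} \<mu> \<phi> E D"
proof -
  define J where "J = jacobian (\<lambda>\<psi>. \<mu> \<psi> s) (at \<phi>)"
  have der: "((\<lambda>\<psi>. \<mu> \<psi> s) has_derivative (*v) J) (at \<phi>)"
    using diff by (simp add: J_def jacobian_works)
  have "surj ((*v) J)"
    using rank by (simp add: J_def full_rank_surjective)
  then obtain g' where g': "linear g'" "(*v) J \<circ> g' = id"
    using linear_surjective_right_inverse[OF matrix_vector_mul_linear] by blast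
  have "\<mu> \<phi> s \<in> interior ((\<lambda>\<psi>. \<mu> \<psi> s) ` ball \<phi> E)"
    using \<open>E > 0\<close> g' der
    by (intro sussmann_open_mapping[where S = "ball \<phi> E" and f' = "(*v) J" and g' = g'])
       (auto intro: continuous_on_subset[OF cont] linear_linear simp: linear_conv_bounded_linear[symmetric])
  then obtain D where D: "D > 0" "cball (\<mu> \<phi> s) D \<subseteq> (\<lambda>\<psi>. \<mu> \<psi> s) ` ball \<phi> E"
    by (auto simp: mem_interior_cball)
  have "\<exists>\<epsilon>. norm \<epsilon> \<le> E \<and> \<mu> (\<phi> + \<epsilon>) s = \<mu> \<phi> s + \<eta>" if "norm \<eta> \<le> D" for \<eta>
  proof -
    have "\<mu> \<phi> s + \<eta> \<in> cball (\<mu> \<phi> s) D"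
      using that by (simp add: dist_norm)
    then obtain \<psi> where "\<psi> \<in> ball \<phi> E" "\<mu> \<psi> s = \<mu> \<phi> s + \<eta>"
      using D(2) by (metis imageE subsetD)
    then show ?thesis
      by (intro exI[of _ "\<psi> - \<phi>"]) (simp add: dist_norm norm_minus_commute)
  qed
  then show ?thesis
    using that[OF D(1)] by (simp add: induced_radius_def)
qed

text \<open>Smaller radii inherit the property, so the minimum of finitely many positive radii
  works.\<close>

lemma induced_radius_finite:
  fixes \<mu> :: "real^'m \<Rightarrow> 's \<Rightarrow> real^'n"
  assumes "finite S" and "\<And>s. s \<in> S \<Longrightarrow> \<exists>D>0. induced_radius {s} \<mu> \<phi> E D"
  shows "\<exists>D>0. induced_radius S \<mu> \<phi> E D"
  using assms
proof (induct S rule: finite_induct)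
  case empty
  show ?case by (rule exI[of _ 1]) (simp add: induced_radius_def)
next
  case (insert s S)
  obtain D where D: "D > 0" "induced_radius S \<mu> \<phi> E D"
    using insert by auto
  obtain D' where D': "D' > 0" "induced_radius {s} \<mu> \<phi> E D'"
    using insert by auto
  show ?case
    using D D' by (intro exI[of _ "min D D'"]) (auto simp: induced_radius_def)
qed

text \<open>Integrated over the centred noise, shifting the action by \<open>\<eta>\<close> and
  shifting the mean by \<open>\<eta>\<close> agree, and the latter is the policy at some
  \<open>\<phi> + \<epsilon>\<close> to which flatness applies.\<close>

lemma induced_radius_action_robust:
  fixes \<mu> :: "real^'m \<Rightarrow> 's \<Rightarrow> real^'n" and C :: "real^'n^'n"
  assumes "induced_radius S \<mu> \<phi> E D" and "flat_reward S (gaussian_policy \<mu> C) R \<phi> E L"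
    and meas: "\<And>s. s \<in> S \<Longrightarrow> R s \<in> borel_measurable borel"
  shows "action_robust S (gaussian_policy \<mu> C) R \<phi> D L"
  unfolding action_robust_def
proof (intro ballI allI impI)
  fix s and \<eta> :: "real^'n" assume s: "s \<in> S" and "norm \<eta> \<le> D"
  then obtain \<epsilon> :: "real^'m" where \<epsilon>: "norm \<epsilon> \<le> E" "\<mu> (\<phi> + \<epsilon>) s = \<mu> \<phi> s + \<eta>"
    using assms(1) by (auto simp: induced_radius_def)
  note [measurable] = meas[OF s]
  have "(LINT a|gaussian_policy \<mu> C (\<phi> + \<epsilon>) s. R s a) = (LINT a|gaussian_policy \<mu> C \<phi> s. R s (a + \<eta>))"
    using integral_gaussian_shift[of "R s" "\<mu> \<phi> s + \<eta>" C]
      integral_gaussian_shift[of "\<lambda>a. R s (a + \<eta>)" "\<mu> \<phi> s" C]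
    by (simp add: gaussian_policy_def \<epsilon>(2) add.assoc add.commute[of \<eta>])
  then show "(LINT a|gaussian_policy \<mu> C \<phi> s. R s a) - (LINT a|gaussian_policy \<mu> C \<phi> s. R s (a + \<eta>)) \<le> L"
    using assms(2) s \<epsilon>(1) by (metis flat_reward_def)
qed

lemma induced_radius_le:
  fixes \<mu> :: "real^'m \<Rightarrow> 's \<Rightarrow> real^'n"
  assumes "induced_radius S \<mu> \<phi> E D" "taylor_bound S \<mu> \<phi> E T" "D > 0" "E > 0" and s: "s \<in> S"
  shows "D \<le> onorm ((*v) (jacobian (\<lambda>\<psi>. \<mu> \<psi> s) (at \<phi>))) * E + T s * E\<^sup>2"
proof -
  define J where "J = jacobian (\<lambda>\<psi>. \<mu> \<psi> s) (at \<phi>)"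
  have T: "norm (\<mu> (\<phi> + \<epsilon>) s - (\<mu> \<phi> s + J *v \<epsilon>)) \<le> T s * (norm \<epsilon>)\<^sup>2" if "norm \<epsilon> \<le> E" for \<epsilon>
    using assms(2) s that by (simp add: taylor_bound_def J_def)
  \<comment> \<open>A parameter step of norm exactly \<open>E > 0\<close> forces
    \<open>T s \<ge> 0\<close>, which later permits replacing \<open>norm \<epsilon>\<close> by
    \<open>E\<close> in the remainder.\<close>
  obtain e :: "real^'m" where e: "norm e = E"
    using \<open>E > 0\<close> vector_choose_size[of E] by auto
  have T0: "T s \<ge> 0"
    using order_trans[OF norm_ge_zero T[of e]] e \<open>E > 0\<close> by (simp add: zero_le_mult_iff)
  \<comment> \<open>The extremal displacement has norm exactly \<open>D\<close>; the step
    \<open>\<epsilon>\<close> that realises it has norm at most \<open>E\<close>, so expanding the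
    mean at \<open>\<epsilon>\<close> bounds \<open>D\<close>.\<close>
  obtain \<eta> :: "real^'n" where \<eta>: "norm \<eta> = D"
    using \<open>D > 0\<close> vector_choose_size[of D] by auto
  obtain \<epsilon> :: "real^'m" where \<epsilon>: "norm \<epsilon> \<le> E" "\<mu> (\<phi> + \<epsilon>) s = \<mu> \<phi> s + \<eta>"
    using assms(1) s \<eta> by (auto simp: induced_radius_def)
  have "D \<le> norm (J *v \<epsilon>) + norm (\<mu> (\<phi> + \<epsilon>) s - (\<mu> \<phi> s + J *v \<epsilon>))"
    using norm_triangle_sub[of \<eta> "J *v \<epsilon>"] by (simp add: \<epsilon>(2) \<eta>)
  also have "norm (J *v \<epsilon>) \<le> onorm ((*v) J) * norm \<epsilon>"
    by (rule onorm) (rule matrix_vector_mul_bounded_linear)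
  also have "\<dots> \<le> onorm ((*v) J) * E"
    by (intro mult_left_mono \<epsilon> onorm_pos_le matrix_vector_mul_bounded_linear)
  also have "norm (\<mu> (\<phi> + \<epsilon>) s - (\<mu> \<phi> s + J *v \<epsilon>)) \<le> T s * (norm \<epsilon>)\<^sup>2"
    by (rule T[OF \<epsilon>(1)])
  also have "\<dots> \<le> T s * E\<^sup>2"
    using \<epsilon>(1) T0 by (intro mult_left_mono power_mono) auto
  finally show ?thesis
    by (simp add: J_def)
qed

subsection \<open>Pairwise robustness\<close>

text \<open>Union bound: each action leaves the ball around its mean with the tail probability of
  the noise, which is the same at every state.\<close>

lemma measure_pair_law_le:
  fixes m :: "'s \<Rightarrow> real^'n" and N :: "(real^'n) measure"
  assumes P: "prob_space P" and N: "prob_space N" and sets: "sets N = sets borel"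
    and [measurable]: "m \<in> borel_measurable P"
    and X: "\<And>s a b. (s, a, b) \<in> X \<Longrightarrow> r < norm (a - m s) \<or> r < norm (b - m s)"
  shows "measure (pair_law P (\<lambda>s. distr N borel (\<lambda>z. m s + z))) X \<le> 2 * measure N {z. r < norm z}"
proof -
  define \<kappa> where "\<kappa> s = distr N borel (\<lambda>z. m s + z)" for s
  define Q where "Q = P \<Otimes>\<^sub>M ((borel :: (real^'n) measure) \<Otimes>\<^sub>M (borel :: (real^'n) measure))"
  define p where "p = emeasure N {z. r < norm z}"
  interpret N: prob_space N by (rule N)
  note [measurable_cong] = sets
  \<comment> \<open>The kernels are kept in \<open>prob_algebra\<close>, where iterated binds are
    measurable and their measures unfold into iterated integrals.\<close>
  have N_in: "N \<in> space (prob_algebra borel)"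
    using N sets by (simp add: space_prob_algebra)
  have \<kappa> [measurable]: "\<kappa> \<in> P \<rightarrow>\<^sub>M prob_algebra borel"
    unfolding \<kappa>_def using N_in by (intro measurable_distr_prob_space2) measurable
  have \<kappa>_in: "\<kappa> s \<in> space (prob_algebra borel)" if "s \<in> space P" for s
    using \<kappa> that by (rule measurable_space)
  have sets_\<kappa> [simp, measurable_cong]: "sets (\<kappa> s) = sets borel" for s
    by (simp add: \<kappa>_def)
  have \<kappa>1: "emeasure (\<kappa> s) UNIV = 1" for s
  proof -
    have "prob_space (\<kappa> s)"
      unfolding \<kappa>_def by (intro N.prob_space_distr) measurable
    then show ?thesis
      using prob_space.emeasure_space_1[of "\<kappa> s"] by (simp add: \<kappa>_def)
  qed
  have tail: "emeasure (\<kappa> s) {a. r < norm (a - m s)} = p" for s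
    unfolding \<kappa>_def p_def using sets_eq_imp_space_eq[OF sets]
    by (subst emeasure_distr) (auto intro!: arg_cong2[where f = emeasure])
  have inner: "(\<lambda>b. return Q (s, a, b)) \<in> borel \<rightarrow>\<^sub>M prob_algebra Q" if "s \<in> space P" for s a
    using that unfolding Q_def by measurable
  have middle: "(\<lambda>a. \<kappa> s \<bind> (\<lambda>b. return Q (s, a, b))) \<in> borel \<rightarrow>\<^sub>M prob_algebra Q"
    if s: "s \<in> space P" for s
    using s \<kappa>_in[OF s] unfolding Q_def by measurable
  have outer: "(\<lambda>s. \<kappa> s \<bind> (\<lambda>a. \<kappa> s \<bind> (\<lambda>b. return Q (s, a, b)))) \<in> P \<rightarrow>\<^sub>M prob_algebra Q"
    unfolding Q_def by measurable
  have law: "pair_law P \<kappa> = P \<bind> (\<lambda>s. \<kappa> s \<bind> (\<lambda>a. \<kappa> s \<bind> (\<lambda>b. return Q (s, a, b))))"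
    by (simp add: pair_law_def Q_def)
  have P_in: "P \<in> space (prob_algebra P)"
    using P by (simp add: space_prob_algebra)
  have sets_law: "sets (pair_law P \<kappa>) = sets Q"
    unfolding law
    by (rule sets_bind[OF _ prob_space.not_empty[OF P]])
       (use measurable_space[OF outer] in \<open>simp add: space_prob_algebra\<close>)
  have "measure (pair_law P \<kappa>) X \<le> 2 * measure N {z. r < norm z}"
  proof (cases "X \<in> sets Q")
    \<comment> \<open>Outside the sigma-algebra \<open>measure\<close> takes the default value
      0.\<close>
    case False
    then show ?thesis
      by (simp add: measure_notin_sets sets_law)
  next
    case True
    have "emeasure (pair_law P \<kappa>) X =
        (\<integral>\<^sup>+s. emeasure (\<kappa> s \<bind> (\<lambda>a. \<kappa> s \<bind> (\<lambda>b. return Q (s, a, b)))) X \<partial>P)"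
      unfolding law by (rule emeasure_bind_prob_algebra[OF P_in outer True])
    also have "\<dots> \<le> (\<integral>\<^sup>+s. 2 * p \<partial>P)"
    proof (rule nn_integral_mono)
      fix s assume s: "s \<in> space P"
      define A where "A = {a. r < norm (a - m s)}"
      have [measurable]: "A \<in> sets borel"
        unfolding A_def by measurable
      have "emeasure (\<kappa> s \<bind> (\<lambda>a. \<kappa> s \<bind> (\<lambda>b. return Q (s, a, b)))) X =
          (\<integral>\<^sup>+a. emeasure (\<kappa> s \<bind> (\<lambda>b. return Q (s, a, b))) X \<partial>\<kappa> s)"
        by (rule emeasure_bind_prob_algebra[OF \<kappa>_in[OF s] middle[OF s] True])
      also have "\<dots> = (\<integral>\<^sup>+a. \<integral>\<^sup>+b. indicator X (s, a, b) \<partial>\<kappa> s \<partial>\<kappa> s)"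
        by (intro nn_integral_cong)
           (simp add: emeasure_bind_prob_algebra[OF \<kappa>_in[OF s] inner[OF s] True] emeasure_return[OF True])
      also have "\<dots> \<le> (\<integral>\<^sup>+a. \<integral>\<^sup>+b. indicator A a + indicator A b \<partial>\<kappa> s \<partial>\<kappa> s)"
        by (intro nn_integral_mono) (auto simp: A_def indicator_def dest!: X)
      also have "\<dots> = p + p"
        using sets_eq_imp_space_eq[OF sets_\<kappa>, of s]
        by (simp add: nn_integral_add \<kappa>1 tail[of s, folded A_def])
      finally show "emeasure (\<kappa> s \<bind> (\<lambda>a. \<kappa> s \<bind> (\<lambda>b. return Q (s, a, b)))) X \<le> 2 * p"
        by (simp add: mult_2)
    qed
    also have "\<dots> = 2 * p"
      using P by (simp add: prob_space.emeasure_space_1)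
    also have "\<dots> = ennreal (2 * measure N {z. r < norm z})"
      by (simp add: p_def N.emeasure_eq_measure ennreal_mult)
    finally show ?thesis
      unfolding measure_def[of "pair_law P \<kappa>"] by (rule enn2real_leI[rotated]) simp
  qed
  then show ?thesis
    by (simp add: \<kappa>_def[abs_def])
qed

text \<open>The radius \<open>D\<close> enters in three stages. It exists over finite sets of
  states, where a minimum of pointwise radii stays positive (an infimum over infinitely many could
  be 0). Any positive induced radius common to all states gives robustness and obeys the Taylor
  bound. The gradient and pairwise claims hold for every positive robustness radius.\<close>

theorem proposition3p3:
  fixes P :: "'s measure"
    and \<mu> :: "real^'m \<Rightarrow> 's \<Rightarrow> real^'n"
    and Cov :: "real^'n^'n"
    and R :: "'s \<Rightarrow> real^'n \<Rightarrow> real"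
    and \<phi> :: "real^'m"
    and \<beta> E L :: real
    and T :: "'s \<Rightarrow> real"
  defines "J \<equiv> \<lambda>s. jacobian (\<lambda>\<psi>. \<mu> \<psi> s) (at \<phi>)"
    and "\<pi> \<equiv> gaussian_policy \<mu> Cov"
    and "EZ \<equiv> LINT z|gaussian 0 Cov. norm z"
  assumes "prob_space P"
    and "\<mu> \<phi> \<in> borel_measurable P"
    and "case_prod R \<in> borel_measurable (P \<Otimes>\<^sub>M borel)"
    and "positive_definite Cov"
    and "\<beta> > 0"
    and "beta_smooth (space P) \<beta> R"
    and "E > 0"
    and "\<And>s. s \<in> space P \<Longrightarrow> continuous_on (cball \<phi> E) (\<lambda>\<psi>. \<mu> \<psi> s)"
    and "\<And>s. s \<in> space P \<Longrightarrow> (\<lambda>\<psi>. \<mu> \<psi> s) differentiable (at \<phi>)"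
    and "taylor_bound (space P) \<mu> \<phi> E T"
    and "\<And>s. s \<in> space P \<Longrightarrow> rank (J s) = CARD('n)"
    and "flat_reward (space P) \<pi> R \<phi> E L"
  shows "(\<forall>S\<subseteq>space P. finite S \<longrightarrow> (\<exists>D>0. induced_radius S \<mu> \<phi> E D)) \<and>
    (\<forall>D>0. induced_radius (space P) \<mu> \<phi> E D \<longrightarrow>
           action_robust (space P) \<pi> R \<phi> D L \<and>
           (\<forall>s\<in>space P. D \<le> onorm ((*v) (J s)) * E + T s * E\<^sup>2)) \<and>
    (\<forall>D>0. action_robust (space P) \<pi> R \<phi> D L \<longrightarrow>
           (let G = L / D + \<beta> / 2 * D + \<beta> * EZ in
             (\<forall>s\<in>space P. norm (grad (R s) (\<mu> \<phi> s)) \<le> G) \<and>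
             (\<forall>\<delta>>0. \<forall>K>0. K / \<delta> > G \<longrightarrow>
               (let r = 1 / \<beta> * (K / \<delta> - G);
                    \<rho> = 2 * measure (gaussian 0 Cov) {z. norm z > r} in
                 (\<forall>s\<in>space P. \<not> (\<exists>a1 a2. norm (a1 - \<mu> \<phi> s) \<le> r \<and> norm (a2 - \<mu> \<phi> s) \<le> r \<and>
                    norm (a1 - a2) \<le> \<delta> \<and> \<bar>R s a1 - R s a2\<bar> > K)) \<and>
                 pairwise_robust P (\<pi> \<phi>) R \<delta> K \<rho>))))"
proof -
  have lip: "lipschitz_gradient (R s) (grad (R s)) \<beta>" if "s \<in> space P" for s
    using beta_smooth_lipschitz_gradient[OF assms(9) that] assms(8) by simp
  have meas: "R s \<in> borel_measurable borel" if "s \<in> space P" for s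
    by (rule lipschitz_gradient.borel_measurable[OF lip[OF that]])
  define \<gamma> where "\<gamma> = gaussian 0 Cov"
  have \<gamma>: "prob_space \<gamma>" "sets \<gamma> = sets borel" "integrable \<gamma> norm" "integrable \<gamma> (\<lambda>z. (norm z)\<^sup>2)"
    using assms(7) by (simp_all add: \<gamma>_def prob_space_gaussian integrable_gaussian_norm integrable_gaussian_norm_square)
  \<comment> \<open>The policy as mean plus noise from the single law \<open>\<gamma>\<close>, the
    form to which \<open>gradient_bound\<close> and \<open>measure_pair_law_le\<close>
    apply.\<close>
  have \<pi>_distr: "\<pi> \<phi> = (\<lambda>s. distr \<gamma> borel (\<lambda>z. \<mu> \<phi> s + z))"
    by (simp add: \<pi>_def gaussian_policy_def fun_eq_iff \<gamma>_def flip: gaussian_eq_distr)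
  show ?thesis
  proof (intro conjI allI impI)
    fix S assume S: "S \<subseteq> space P" "finite S"
    show "\<exists>D>0. induced_radius S \<mu> \<phi> E D"
    proof (rule induced_radius_finite[OF S(2)])
      fix s assume "s \<in> S"
      then have s: "s \<in> space P"
        using S by auto
      show "\<exists>D>0. induced_radius {s} \<mu> \<phi> E D"
        by (rule induced_radius_point[of E \<phi> \<mu> s, OF assms(10) assms(11,12)[OF s] assms(14)[OF s, unfolded J_def]]) blast
    qed
  next
    fix D assume "induced_radius (space P) \<mu> \<phi> E D"
    then show "action_robust (space P) \<pi> R \<phi> D L"
      using assms(15) meas unfolding \<pi>_def by (rule induced_radius_action_robust)
  next
    fix D :: real assume "D > 0" "induced_radius (space P) \<mu> \<phi> E D"
    then show "\<forall>s\<in>space P. D \<le> onorm ((*v) (J s)) * E + T s * E\<^sup>2"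
      using induced_radius_le[OF _ assms(13) _ assms(10)] by (simp add: J_def)
  next
    fix D :: real assume D: "D > 0" and robust: "action_robust (space P) \<pi> R \<phi> D L"
    define G where "G = L / D + \<beta> / 2 * D + \<beta> * EZ"
    have G: "norm (grad (R s) (\<mu> \<phi> s)) \<le> G" if s: "s \<in> space P" for s
      unfolding G_def EZ_def \<gamma>_def[symmetric]
    proof (rule lipschitz_gradient.gradient_bound[OF lip[OF s] \<gamma> D])
      fix h :: "real^'n" assume "norm h \<le> D"
      then have "(LINT a|\<pi> \<phi> s. R s a) - (LINT a|\<pi> \<phi> s. R s (a + h)) \<le> L"
        using robust s by (simp add: action_robust_def)
      then show "(LINT z|\<gamma>. R s (\<mu> \<phi> s + z)) - (LINT z|\<gamma>. R s (\<mu> \<phi> s + z + h)) \<le> L"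
        using meas[OF s] \<gamma>(2)
        by (simp add: \<pi>_distr integral_distr)
    qed
    have "(\<forall>s\<in>space P. \<not> (\<exists>a1 a2. norm (a1 - \<mu> \<phi> s) \<le> r \<and> norm (a2 - \<mu> \<phi> s) \<le> r \<and>
              norm (a1 - a2) \<le> \<delta> \<and> \<bar>R s a1 - R s a2\<bar> > K)) \<and>
          pairwise_robust P (\<pi> \<phi>) R \<delta> K (2 * measure \<gamma> {z. norm z > r})"
      if "\<delta> > 0" "K > 0" and r: "r = 1 / \<beta> * (K / \<delta> - G)" for \<delta> K r
    proof -
      \<comment> \<open>The radius \<open>r\<close> is chosen to make the slope on the ball exactly
        \<open>K / \<delta>\<close>, so that over a distance \<open>\<delta>\<close> the reward
        changes by at most \<open>K\<close>.\<close>
      have slope: "G + \<beta> * r = K / \<delta>"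
        using assms(8) by (simp add: r)
      have safe: "\<bar>R s a - R s b\<bar> \<le> K"
        if s: "s \<in> space P" and ab: "norm (a - \<mu> \<phi> s) \<le> r" "norm (b - \<mu> \<phi> s) \<le> r" "norm (a - b) \<le> \<delta>"
        for s a b
      proof -
        have "\<bar>R s a - R s b\<bar> \<le> K / \<delta> * norm (a - b)"
          using lipschitz_gradient.lipschitz_near[OF lip[OF s] G[OF s] ab(1,2)] by (simp add: slope)
        also have "\<dots> \<le> K / \<delta> * \<delta>"
          using ab(3) \<open>\<delta> > 0\<close> \<open>K > 0\<close> by (intro mult_left_mono) auto
        finally show ?thesis
          using \<open>\<delta> > 0\<close> by simp
      qed
      moreover have "measure (pair_law P (\<pi> \<phi>)) (sharpness_set P K \<delta> R) \<le> 2 * measure \<gamma> {z. r < norm z}"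
        unfolding \<pi>_distr
      proof (rule measure_pair_law_le[OF assms(4) \<gamma>(1,2) assms(5)])
        \<comment> \<open>Contrapositive of \<open>safe\<close>: a violating pair has an action
          farther than \<open>r\<close> from the mean.\<close>
        fix s a b assume "(s, a, b) \<in> sharpness_set P K \<delta> R"
        then show "r < norm (a - \<mu> \<phi> s) \<or> r < norm (b - \<mu> \<phi> s)"
          using safe[of s a b] by (force simp: sharpness_set_def)
      qed
      ultimately show ?thesis
        by (force simp: pairwise_robust_def)
    qed
    then show "let G = L / D + \<beta> / 2 * D + \<beta> * EZ in
             (\<forall>s\<in>space P. norm (grad (R s) (\<mu> \<phi> s)) \<le> G) \<and>
             (\<forall>\<delta>>0. \<forall>K>0. K / \<delta> > G \<longrightarrow>
               (let r = 1 / \<beta> * (K / \<delta> - G);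
                    \<rho> = 2 * measure (gaussian 0 Cov) {z. norm z > r} in
                 (\<forall>s\<in>space P. \<not> (\<exists>a1 a2. norm (a1 - \<mu> \<phi> s) \<le> r \<and> norm (a2 - \<mu> \<phi> s) \<le> r \<and>
                    norm (a1 - a2) \<le> \<delta> \<and> \<bar>R s a1 - R s a2\<bar> > K)) \<and>
                 pairwise_robust P (\<pi> \<phi>) R \<delta> K \<rho>))"
      using G unfolding Let_def G_def[symmetric] \<gamma>_def[symmetric] by blast
  qed
qed

end
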